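(* There is a quantum $k$-party $\mathsf{SMP}$ protocol (no shared randomness or entanglement) for $\mathrm{GroupByEQ}_{k,n}$ with communication cost $O(k\log k\log n)$ that outputs a correct answer with probability at least $2/3$ on every input.
   Context: Quantum $k$-party $\mathsf{SMP}$ model: $k$ players with private inputs $x_1,\dots,x_k\in\{0,1\}^n$ each send one quantum message, depending only on their own input, to a referee, who outputs an answer; cost is the total number of qubits sent. $\mathrm{GroupByEQ}_{k,n}$: the referee must output a partition $P_1,\dots,P_s$ of $[k]$ such that for all $i,j\in[k]$, $i$ and $j$ lie in a common part if and only if $x_i=x_j$. *)

theory Defs
  imports Complex_Main "Jordan_Normal_Form.Matrix" "HOL-Library.Disjoint_Sets"
begin

definition mtrace :: "complex mat \<Rightarrow> complex" where
  "mtrace A = (\<Sum>i<dim_row A. A $$ (i, i))"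

definition hermitian_mat :: "complex mat \<Rightarrow> bool" where
  "hermitian_mat A \<longleftrightarrow> dim_row A = dim_col A \<and>
     (\<forall>i<dim_row A. \<forall>j<dim_row A. A $$ (i, j) = cnj (A $$ (j, i)))"

definition psd_mat :: "complex mat \<Rightarrow> bool" where
  "psd_mat A \<longleftrightarrow> hermitian_mat A \<and>
     (\<forall>v \<in> carrier_vec (dim_row A).
        0 \<le> Re (\<Sum>i<dim_row A. cnj (v $ i) * (A *\<^sub>v v) $ i))"

definition density_mat :: "nat \<Rightarrow> complex mat \<Rightarrow> bool" where
  "density_mat d A \<longleftrightarrow> A \<in> carrier_mat d d \<and> psd_mat A \<and> mtrace A = 1"

definition kron :: "complex mat \<Rightarrow> complex mat \<Rightarrow> complex mat" where
  "kron A B = mat (dim_row A * dim_row B) (dim_col A * dim_col B)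
     (\<lambda>(i, j). A $$ (i div dim_row B, j div dim_col B) * B $$ (i mod dim_row B, j mod dim_col B))"

definition povm :: "nat \<Rightarrow> 'o set \<Rightarrow> ('o \<Rightarrow> complex mat) \<Rightarrow> bool" where
  "povm d Out E \<longleftrightarrow> finite Out \<and>
     (\<forall>P\<in>Out. E P \<in> carrier_mat d d \<and> psd_mat (E P)) \<and>
     (\<forall>i<d. \<forall>j<d. (\<Sum>P\<in>Out. E P $$ (i, j)) = (1\<^sub>m d) $$ (i, j))"

text \<open>Players are indexed by 0..k-1. Player i sends q i qubits: on input y it sends the
  state enc i y, a density matrix of dimension 2^(q i) (local randomness allowed via mixed
  states; no shared randomness/entanglement). The referee measures the product state of all
  messages with a POVM whose outcomes are candidate partitions.\<close>

definition joint_state :: "nat \<Rightarrow> (nat \<Rightarrow> bool list \<Rightarrow> complex mat) \<Rightarrow> (nat \<Rightarrow> bool list) \<Rightarrow> complex mat" where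
  "joint_state k enc x = foldr kron (map (\<lambda>i. enc i (x i)) [0..<k]) (1\<^sub>m 1)"

definition smp_cost :: "nat \<Rightarrow> (nat \<Rightarrow> nat) \<Rightarrow> nat" where
  "smp_cost k q = (\<Sum>i<k. q i)"

definition valid_smp_protocol ::
  "nat \<Rightarrow> nat \<Rightarrow> (nat \<Rightarrow> nat) \<Rightarrow> (nat \<Rightarrow> bool list \<Rightarrow> complex mat) \<Rightarrow> 'o set \<Rightarrow> ('o \<Rightarrow> complex mat) \<Rightarrow> bool" where
  "valid_smp_protocol k n q enc Out E \<longleftrightarrow>
     (\<forall>i<k. \<forall>y. length y = n \<longrightarrow> density_mat (2 ^ q i) (enc i y)) \<and>
     povm (2 ^ smp_cost k q) Out E"

definition success_prob ::
  "nat \<Rightarrow> (nat \<Rightarrow> bool list \<Rightarrow> complex mat) \<Rightarrow> 'o set \<Rightarrow> ('o \<Rightarrow> complex mat) \<Rightarrow> ('o \<Rightarrow> bool) \<Rightarrow> (nat \<Rightarrow> bool list) \<Rightarrow> real" where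
  "success_prob k enc Out E ok x =
     (\<Sum>P\<in>{P\<in>Out. ok P}. Re (mtrace (E P * joint_state k enc x)))"

definition groupByEQ_correct :: "nat \<Rightarrow> (nat \<Rightarrow> bool list) \<Rightarrow> nat set set \<Rightarrow> bool" where
  "groupByEQ_correct k x P \<longleftrightarrow> partition_on {..<k} P \<and>
     (\<forall>i<k. \<forall>j<k. (\<exists>B\<in>P. i \<in> B \<and> j \<in> B) \<longleftrightarrow> x i = x j)"

end

theory Submission
  imports Defs "HOL-Library.FuncSet" "HOL-Analysis.L2_Norm" "HOL-Combinatorics.Permutations"
begin

text \<open>Each player sends \<open>m = O(log k)\<close> copies of the fingerprint \<open>(1 / sqrt L) \<Sum>\<^sub>t |t, c y t>\<close> of
  its input \<open>y\<close>, where \<open>c\<close> is a code over an alphabet of size 16, found greedily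
  (Gilbert--Varshamov), in which different words agree on at most half of the \<open>L = O(n)\<close> positions.
  For every pair of players the referee performs the swap tests of all corresponding copies as
  one two-outcome projective measurement. Its accepting projection is the average, over all sets
  \<open>S\<close> of copies, of the operators that exchange the copies in \<open>S\<close>. Equal inputs pass without
  disturbance; for different inputs the accepted component has squared norm at most
  \<open>(3/4)\<^sup>m = O(k\<^sup>-\<^sup>4)\<close>. Hence performing the \<open>k\<^sup>2\<close> tests one after the other and seeing the
  correct outcome each time moves the state by at most \<open>1/10\<close> in norm, so this happens with
  probability at least \<open>(9/10)\<^sup>2\<close>. All amplitudes are real.\<close>

subsection \<open>Codes with pairwise agreement at most one half\<close>

lemma card_PiE_agreeing:
  fixes w :: "'t \<Rightarrow> nat"
  assumes "finite I" "T \<subseteq> I" "w \<in> I \<rightarrow>\<^sub>E {..<A}"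
  shows "card {v \<in> I \<rightarrow>\<^sub>E {..<A}. \<forall>t\<in>T. v t = w t} = A ^ (card I - card T)"
proof -
  have "{v \<in> I \<rightarrow>\<^sub>E {..<A}. \<forall>t\<in>T. v t = w t} = (\<Pi>\<^sub>E t\<in>I. if t \<in> T then {w t} else {..<A})"
  proof (rule Set.set_eqI)
    fix v
    have w: "w t < A" if "t \<in> I" for t
      using assms(3) that by (auto simp: PiE_iff)
    have "(\<forall>t\<in>I. v t \<in> (if t \<in> T then {w t} else {..<A})) \<longleftrightarrow>
        (\<forall>t\<in>I. (t \<in> T \<longrightarrow> v t = w t) \<and> v t < A)"
      by (intro ball_cong refl) (auto simp: w)
    also have "\<dots> \<longleftrightarrow> (\<forall>t\<in>I. v t < A) \<and> (\<forall>t\<in>T. v t = w t)"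
      using assms(2) by blast
    finally have "(\<forall>t\<in>I. v t \<in> (if t \<in> T then {w t} else {..<A})) \<longleftrightarrow>
        (\<forall>t\<in>I. v t < A) \<and> (\<forall>t\<in>T. v t = w t)" .
    then show "v \<in> {v \<in> I \<rightarrow>\<^sub>E {..<A}. \<forall>t\<in>T. v t = w t} \<longleftrightarrow> v \<in> (\<Pi>\<^sub>E t\<in>I. if t \<in> T then {w t} else {..<A})"
      by (auto simp only: PiE_iff mem_Collect_eq lessThan_iff)
  qed
  moreover have "card (\<Pi>\<^sub>E t\<in>I. if t \<in> T then {w t} else {..<A}) = (\<Prod>t\<in>I. if t \<in> T then 1 else A)"
    using assms(1) by (subst card_PiE) (auto intro!: prod.cong)
  moreover have "(\<Prod>t\<in>I. if t \<in> T then 1 else A) = (\<Prod>t\<in>I - T. A)"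
    using assms(1) by (intro prod.mono_neutral_cong_right) auto
  moreover have "card (I - T) = card I - card T"
    using assms by (intro card_Diff_subset) (auto intro: finite_subset)
  ultimately show ?thesis by simp
qed

text \<open>Union bound over the set \<open>T\<close> of positions of agreement: there are at most
  \<open>2 ^ (2*h)\<close> such sets, and once more than \<open>h\<close> coordinates are forced,
  fewer than \<open>h\<close> of them remain free.\<close>

lemma card_half_agreeing_le:
  fixes w :: "nat \<Rightarrow> nat"
  assumes w: "w \<in> {..<2*h} \<rightarrow>\<^sub>E {..<A}" and A: "A > 0"
  shows "card {v \<in> {..<2*h} \<rightarrow>\<^sub>E {..<A}. h < card {t\<in>{..<2*h}. v t = w t}} \<le> 2 ^ (2*h) * A ^ h"
proof -
  let ?I = "{..<2*h}"
  let ?V = "\<lambda>T. {v \<in> ?I \<rightarrow>\<^sub>E {..<A}. \<forall>t\<in>T. v t = w t}"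
  let ?Ts = "{T \<in> Pow ?I. h < card T}"
  have fin: "finite ?Ts" by simp
  have "{v \<in> ?I \<rightarrow>\<^sub>E {..<A}. h < card {t\<in>?I. v t = w t}} \<subseteq> (\<Union>T\<in>?Ts. ?V T)"
  proof
    fix v assume v: "v \<in> {v \<in> ?I \<rightarrow>\<^sub>E {..<A}. h < card {t\<in>?I. v t = w t}}"
    then have "{t\<in>?I. v t = w t} \<in> ?Ts" "v \<in> ?V {t\<in>?I. v t = w t}" by auto
    then show "v \<in> (\<Union>T\<in>?Ts. ?V T)" by blast
  qed
  then have "card {v \<in> ?I \<rightarrow>\<^sub>E {..<A}. h < card {t\<in>?I. v t = w t}} \<le> card (\<Union>T\<in>?Ts. ?V T)"
    by (intro card_mono) (auto intro!: finite_subset[OF _ finite_PiE[of ?I "\<lambda>_. {..<A}"]])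
  also have "\<dots> \<le> (\<Sum>T\<in>?Ts. card (?V T))"
    by (rule card_UN_le[OF fin])
  also have "\<dots> \<le> (\<Sum>T\<in>?Ts. A ^ h)"
  proof (rule sum_mono)
    fix T assume "T \<in> ?Ts"
    then show "card (?V T) \<le> A ^ h"
      using card_PiE_agreeing[OF _ _ w, of T] A by (auto intro!: power_increasing)
  qed
  also have "\<dots> \<le> (\<Sum>T\<in>Pow ?I. A ^ h)"
    by (rule sum_mono2) auto
  also have "\<dots> = 2 ^ (2*h) * A ^ h"
    by (simp add: card_Pow)
  finally show ?thesis .
qed

text \<open>Greedy choice: as long as fewer than \<open>2 ^ (2*h)\<close> codewords are fixed, the
  words agreeing too often with one of them cannot exhaust the whole space, so a further codeword is
  available.\<close>

lemma half_agreement_code_exists: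
  assumes "finite Y" "card Y \<le> 2 ^ (2*h)"
  shows "\<exists>c :: 'y \<Rightarrow> nat \<Rightarrow> nat. (\<forall>y\<in>Y. c y \<in> {..<2*h} \<rightarrow>\<^sub>E {..<16}) \<and>
    (\<forall>y\<in>Y. \<forall>z\<in>Y. y \<noteq> z \<longrightarrow> card {t\<in>{..<2*h}. c y t = c z t} \<le> h)"
  using assms
proof (induction Y rule: finite_induct)
  case empty
  then show ?case by simp
next
  case (insert y Y)
  let ?I = "{..<2*h}" and ?U = "{..<2*h} \<rightarrow>\<^sub>E {..<16::nat}"
  have "card Y \<le> 2 ^ (2*h)" using insert by simp
  from insert.IH[OF this] obtain c :: "'y \<Rightarrow> nat \<Rightarrow> nat" where c: "\<And>y. y \<in> Y \<Longrightarrow> c y \<in> ?U"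
    "\<And>y z. y \<in> Y \<Longrightarrow> z \<in> Y \<Longrightarrow> y \<noteq> z \<Longrightarrow> card {t\<in>?I. c y t = c z t} \<le> h"
    by blast
  let ?B = "\<lambda>z. {v \<in> ?U. h < card {t\<in>?I. v t = c z t}}"
  have "card (\<Union>z\<in>Y. ?B z) \<le> (\<Sum>z\<in>Y. card (?B z))"
    using insert by (intro card_UN_le)
  also have "\<dots> \<le> (\<Sum>z\<in>Y. 2 ^ (2*h) * 16 ^ h)"
    using c(1) by (intro sum_mono card_half_agreeing_le) auto
  also have "\<dots> = card Y * (2 ^ (2*h) * 16 ^ h)" by simp
  \<comment> \<open>Strict because \<open>y\<close> is not yet in \<open>Y\<close>, so
    \<open>card Y\<close> stays below the bound for \<open>insert y Y\<close>.\<close>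
  also have "\<dots> < 2 ^ (2*h) * (2 ^ (2*h) * 16 ^ h)"
    using insert by (intro mult_strict_right_mono) auto
  \<comment> \<open>This fixes the alphabet size: \<open>4 ^ h * 4 ^ h\<close> equals
    \<open>16 ^ h\<close> exactly.\<close>
  also have "\<dots> = (16::nat) ^ (2*h)"
    by (simp add: power_mult power_mult_distrib[symmetric] power2_eq_square)
  also have "\<dots> = card ?U"
    by (simp add: card_PiE)
  finally have "card (\<Union>z\<in>Y. ?B z) < card ?U" .
  moreover have "finite (\<Union>z\<in>Y. ?B z)"
    using insert(1) by (auto intro!: finite_subset[OF _ finite_PiE[of ?I "\<lambda>_. {..<16}"]])
  ultimately have "\<not> ?U \<subseteq> (\<Union>z\<in>Y. ?B z)"
    by (meson card_mono leD)
  then obtain v where "v \<in> ?U" "v \<notin> (\<Union>z\<in>Y. ?B z)" by blast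
  then have v: "v \<in> ?U" "\<And>z. z \<in> Y \<Longrightarrow> card {t\<in>?I. v t = c z t} \<le> h"
    by (simp_all add: not_less)
  have v': "card {t\<in>?I. c z t = v t} \<le> h" if "z \<in> Y" for z
    using v(2)[OF that] by (simp only: eq_commute)
  have "(c(y := v)) z \<in> ?U" if "z \<in> insert y Y" for z
    using that v(1) c(1) by (cases "z = y") simp_all
  moreover have "card {t\<in>?I. (c(y := v)) z t = (c(y := v)) z' t} \<le> h"
    if "z \<in> insert y Y" "z' \<in> insert y Y" "z \<noteq> z'" for z z'
    using that v(2) v' c(2) by (cases "z = y"; cases "z' = y") simp_all
  ultimately show ?case by blast
qed

subsection \<open>Entries of iterated Kronecker products\<close>

text \<open>A row index of the big matrix is a \<open>k\<close>-digit number in base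
  \<open>d\<close>, and \<open>e\<close> decodes it into a tuple of local basis labels. Since
  \<open>e\<close> is chosen before \<open>A\<close> and \<open>g\<close>, one labelling serves all
  inputs; the referee's measurement, which cannot depend on the input, is written in it.\<close>

lemma foldr_kron_entries:
  assumes h: "bij_betw h {..<d} W"
  shows "\<exists>e. bij_betw e {..<d^k} ({..<k} \<rightarrow>\<^sub>E W) \<and>
    (\<forall>A g. (\<forall>i<k. A i = mat d d (\<lambda>(a, b). g i (h a) (h b))) \<longrightarrow>
      foldr kron (map A [0..<k]) (1\<^sub>m 1) =
        mat (d^k) (d^k) (\<lambda>(a, b). \<Prod>i<k. g i (e a i) (e b i)))"
proof (induction k)
  case 0
  have "(\<lambda>_::nat. \<lambda>_::nat. undefined) ` {..<1::nat} = {\<lambda>_. undefined :: 'a}" by auto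
  then have "bij_betw (\<lambda>_::nat. \<lambda>_::nat. undefined :: 'a) {..<d^0} ({..<0} \<rightarrow>\<^sub>E W)"
    by (auto simp: bij_betw_def inj_on_def)
  then show ?case by (intro exI conjI) (auto intro!: eq_matI)
next
  case (Suc k)
  then obtain e where e: "bij_betw e {..<d^k} ({..<k} \<rightarrow>\<^sub>E W)"
    and ent: "\<And>A g. (\<forall>i<k. A i = mat d d (\<lambda>(a, b). g i (h a) (h b))) \<Longrightarrow>
      foldr kron (map A [0..<k]) (1\<^sub>m 1) =
        mat (d^k) (d^k) (\<lambda>(a, b). \<Prod>i<k. g i (e a i) (e b i))" by blast
  \<comment> \<open>The leading digit belongs to player 0, the leftmost Kronecker factor; the
    remaining digits go to the other players, shifted by one. For \<open>i > k\<close> the value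
    \<open>undefined\<close> is inherited from \<open>e\<close>.\<close>
  define e' where "e' a = (\<lambda>i. if i = 0 then h (a div d^k) else e (a mod d^k) (i - 1))" for a
  have d: "a div d^k < d" "a mod d^k < d^k" if "a < d ^ Suc k" for a
    using that by (auto simp: less_mult_imp_div_less intro!: mod_less_divisor gr0I)
  have W: "finite W" "card W = d"
    using h bij_betw_finite bij_betw_same_card by fastforce+
  have inj: "inj_on e' {..<d ^ Suc k}"
  proof (rule inj_onI)
    fix a b assume ab: "a \<in> {..<d ^ Suc k}" "b \<in> {..<d ^ Suc k}" and eq: "e' a = e' b"
    have "h (a div d^k) = h (b div d^k)" using fun_cong[OF eq, of 0] by (simp add: e'_def)
    then have 1: "a div d^k = b div d^k"
      using h d ab by (auto simp: bij_betw_def inj_on_def)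
    have "e (a mod d^k) i = e (b mod d^k) i" for i
      using fun_cong[OF eq, of "Suc i"] by (simp add: e'_def)
    then have "e (a mod d^k) = e (b mod d^k)" by blast
    then have 2: "a mod d^k = b mod d^k"
      using e d(2) ab by (auto simp: bij_betw_def inj_on_def)
    show "a = b" using 1 2 by (metis div_mult_mod_eq)
  qed
  have into: "e' a \<in> {..<Suc k} \<rightarrow>\<^sub>E W" if a: "a < d ^ Suc k" for a
  proof -
    have "h (a div d^k) \<in> W" using h d(1)[OF a] by (auto simp: bij_betw_def)
    moreover have "e (a mod d^k) \<in> {..<k} \<rightarrow>\<^sub>E W" using e d(2)[OF a] by (auto simp: bij_betw_def)
    ultimately show ?thesis unfolding e'_def PiE_iff extensional_def
      by (auto split: if_splits)
  qed
  \<comment> \<open>Surjectivity comes from counting: an injection between finite sets of equal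
    size.\<close>
  have "card (e' ` {..<d ^ Suc k}) = card ({..<Suc k} \<rightarrow>\<^sub>E W)"
    using W card_image[OF inj] by (simp add: card_PiE)
  then have "e' ` {..<d ^ Suc k} = ({..<Suc k} \<rightarrow>\<^sub>E W)"
    using into W by (intro card_subset_eq finite_PiE) auto
  with inj have bij: "bij_betw e' {..<d ^ Suc k} ({..<Suc k} \<rightarrow>\<^sub>E W)"
    by (simp add: bij_betw_def)
  have "foldr kron (map A [0..<Suc k]) (1\<^sub>m 1) =
        mat (d ^ Suc k) (d ^ Suc k) (\<lambda>(a, b). \<Prod>i<Suc k. g i (e' a i) (e' b i))"
    if A: "\<forall>i<Suc k. A i = mat d d (\<lambda>(a, b). g i (h a) (h b))" for A g
  proof -
    have "map A [0..<Suc k] = A 0 # map (\<lambda>i. A (Suc i)) [0..<k]"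
      by (simp add: upt_conv_Cons map_Suc_upt[symmetric] del: upt_Suc)
    then have "foldr kron (map A [0..<Suc k]) (1\<^sub>m 1) = kron (A 0)
        (mat (d^k) (d^k) (\<lambda>(a, b). \<Prod>i<k. g (Suc i) (e a i) (e b i)))"
      using ent[of "\<lambda>i. A (Suc i)" "\<lambda>i. g (Suc i)"] A by simp
    also have "\<dots> = mat (d ^ Suc k) (d ^ Suc k) (\<lambda>(a, b). \<Prod>i<Suc k. g i (e' a i) (e' b i))"
      using A d by (intro eq_matI) (simp_all add: kron_def e'_def prod.lessThan_Suc_shift del: prod.lessThan_Suc)
    finally show ?thesis .
  qed
  with bij show ?case by blast
qed

subsection \<open>Sequences of projective measurements\<close>

definition inner_on :: "'w set \<Rightarrow> ('w \<Rightarrow> real) \<Rightarrow> ('w \<Rightarrow> real) \<Rightarrow> real" where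
  "inner_on \<Omega> u v = (\<Sum>\<omega>\<in>\<Omega>. u \<omega> * v \<omega>)"

lemma L2_set_eq_sqrt_inner_on: "L2_set u \<Omega> = sqrt (inner_on \<Omega> u u)"
  by (simp add: L2_set_def inner_on_def power2_eq_square)

lemma inner_on_self_nonneg: "inner_on \<Omega> u u \<ge> 0"
  by (simp add: inner_on_def sum_nonneg)

text \<open>The quadratic form at \<open>v\<close> is the sum over \<open>s\<close> of the squared
  moduli of \<open>\<Sum>b<N. g s b * v $ b\<close>. Both the messages and the POVM elements are
  recognised as positive through this form.\<close>

lemma psd_mat_gram:
  fixes g :: "'s \<Rightarrow> nat \<Rightarrow> real"
  shows "psd_mat (mat N N (\<lambda>(a, b). complex_of_real (\<Sum>s\<in>S. g s a * g s b)))" (is "psd_mat ?A")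
  unfolding psd_mat_def
proof (intro conjI ballI)
  show "hermitian_mat ?A"
    by (auto simp: hermitian_mat_def mult.commute)
next
  fix v :: "complex vec" assume v: "v \<in> carrier_vec (dim_row ?A)"
  let ?z = "\<lambda>s. \<Sum>b<N. complex_of_real (g s b) * v $ b"
  have "(\<Sum>a<dim_row ?A. cnj (v $ a) * (?A *\<^sub>v v) $ a) =
        (\<Sum>a<N. cnj (v $ a) * (\<Sum>b<N. (\<Sum>s\<in>S. complex_of_real (g s a * g s b)) * v $ b))"
    using v by (simp add: mult_mat_vec_def scalar_prod_def atLeast0LessThan)
  also have "\<dots> = (\<Sum>a<N. \<Sum>b<N. \<Sum>s\<in>S. cnj (v $ a) * g s a * (g s b * v $ b))"
    by (simp add: sum_distrib_left sum_distrib_right mult_ac)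
  also have "\<dots> = (\<Sum>a<N. \<Sum>s\<in>S. \<Sum>b<N. cnj (v $ a) * g s a * (g s b * v $ b))"
    by (intro sum.cong refl sum.swap)
  also have "\<dots> = (\<Sum>s\<in>S. \<Sum>a<N. \<Sum>b<N. cnj (v $ a) * g s a * (g s b * v $ b))"
    by (rule sum.swap)
  also have "\<dots> = (\<Sum>s\<in>S. cnj (?z s) * ?z s)"
  proof (rule sum.cong[OF refl])
    fix s
    have "cnj (?z s) = (\<Sum>a<N. cnj (v $ a) * g s a)" by (simp add: mult.commute)
    then show "(\<Sum>a<N. \<Sum>b<N. cnj (v $ a) * g s a * (g s b * v $ b)) = cnj (?z s) * ?z s"
      by (simp only: sum_product)
  qed
  also have "\<dots> = (\<Sum>s\<in>S. complex_of_real ((cmod (?z s))\<^sup>2))"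
    by (intro sum.cong refl) (simp only: complex_norm_square mult.commute)
  also have "Re \<dots> = (\<Sum>s\<in>S. (cmod (?z s))\<^sup>2)"
    by (simp only: Re_sum Re_complex_of_real)
  also have "\<dots> \<ge> 0" by (intro sum_nonneg) simp
  finally show "0 \<le> Re (\<Sum>a<dim_row ?A. cnj (v $ a) * (?A *\<^sub>v v) $ a)" .
qed

text \<open>A family of orthogonal projections on the real functions over \<open>\<Omega>\<close>,
  possibly not commuting. Vectors are total functions, so \<open>Q_cong\<close> records that values
  outside \<open>\<Omega>\<close> have no influence inside. \<open>Q_sum\<close> is linearity for
  sums indexed by \<open>'w\<close>, the shape of an expansion in basis vectors.\<close>

locale projective_tests =
  fixes \<Omega> :: "'w set" and P :: "'p set" and Q :: "'p \<Rightarrow> ('w \<Rightarrow> real) \<Rightarrow> 'w \<Rightarrow> real"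
  assumes finite_index: "finite \<Omega>"
    and Q_cong: "\<And>p u v \<omega>. p \<in> P \<Longrightarrow> (\<And>\<omega>. \<omega> \<in> \<Omega> \<Longrightarrow> u \<omega> = v \<omega>) \<Longrightarrow> \<omega> \<in> \<Omega> \<Longrightarrow> Q p u \<omega> = Q p v \<omega>"
    and Q_diff: "\<And>p u v. p \<in> P \<Longrightarrow> Q p (\<lambda>\<omega>. u \<omega> - v \<omega>) = (\<lambda>\<omega>. Q p u \<omega> - Q p v \<omega>)"
    and Q_sum: "\<And>p A c (f :: 'w \<Rightarrow> 'w \<Rightarrow> real). p \<in> P \<Longrightarrow>
      Q p (\<lambda>\<omega>. \<Sum>a\<in>A. c a * f a \<omega>) = (\<lambda>\<omega>. \<Sum>a\<in>A. c a * Q p (f a) \<omega>)"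
    and Q_self_adjoint: "\<And>p u v. p \<in> P \<Longrightarrow> inner_on \<Omega> (Q p u) v = inner_on \<Omega> u (Q p v)"
    and Q_idem: "\<And>p u. p \<in> P \<Longrightarrow> Q p (Q p u) = Q p u"
begin

definition branch :: "'p \<Rightarrow> 'p set \<Rightarrow> ('w \<Rightarrow> real) \<Rightarrow> 'w \<Rightarrow> real" where
  "branch p T u = (if p \<in> T then Q p u else (\<lambda>\<omega>. u \<omega> - Q p u \<omega>))"

text \<open>The unnormalised state left when the tests in the list are performed in turn and exactly
  those in \<open>T\<close> accept.\<close>

fun collapse :: "'p list \<Rightarrow> 'p set \<Rightarrow> ('w \<Rightarrow> real) \<Rightarrow> 'w \<Rightarrow> real" where
  "collapse [] T u = u"
| "collapse (p # ps) T u = collapse ps T (branch p T u)"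

text \<open>Pythagoras for the complementary projections \<open>Q p\<close> and
  \<open>1 - Q p\<close>, in polarised form: completeness of the POVM also concerns off-diagonal
  entries, hence two vectors \<open>u\<close> and \<open>v\<close>.\<close>

lemma branch_inner_sum:
  assumes "p \<in> P"
  shows "inner_on \<Omega> (Q p u) (Q p v) + inner_on \<Omega> (\<lambda>\<omega>. u \<omega> - Q p u \<omega>) (\<lambda>\<omega>. v \<omega> - Q p v \<omega>)
    = inner_on \<Omega> u v"
proof -
  have "inner_on \<Omega> (Q p u) (Q p v) = inner_on \<Omega> u (Q p v)"
    using assms by (simp add: Q_self_adjoint Q_idem)
  moreover have "inner_on \<Omega> (\<lambda>\<omega>. u \<omega> - Q p u \<omega>) (\<lambda>\<omega>. v \<omega> - Q p v \<omega>) =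
      inner_on \<Omega> u v - inner_on \<Omega> u (Q p v) - inner_on \<Omega> (Q p u) v + inner_on \<Omega> (Q p u) (Q p v)"
    by (simp add: inner_on_def algebra_simps sum.distrib sum_subtractf)
  moreover have "inner_on \<Omega> (Q p u) v = inner_on \<Omega> u (Q p v)"
    using assms by (rule Q_self_adjoint)
  ultimately show ?thesis by simp
qed

lemma branch_norm_le: "p \<in> P \<Longrightarrow> inner_on \<Omega> (branch p T u) (branch p T u) \<le> inner_on \<Omega> u u"
  using branch_inner_sum[of p u u] inner_on_self_nonneg[of \<Omega> "Q p u"]
    inner_on_self_nonneg[of \<Omega> "\<lambda>\<omega>. u \<omega> - Q p u \<omega>"]
  by (simp add: branch_def)

lemma collapse_norm_le:
  "set ps \<subseteq> P \<Longrightarrow> inner_on \<Omega> (collapse ps T u) (collapse ps T u) \<le> inner_on \<Omega> u u"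
proof (induction ps arbitrary: u)
  case (Cons p ps)
  then show ?case using branch_norm_le[of p T u] by (force intro: order_trans)
qed simp

lemma collapse_insert: "p \<notin> set ps \<Longrightarrow> collapse ps (insert p T) u = collapse ps T u"
  by (induction ps arbitrary: u) (auto simp: branch_def)

text \<open>Completeness of the sequential measurement: with \<open>K\<^sub>T\<close> the operator
  \<open>collapse ps T\<close>, the sum of all adjoint products of \<open>K\<^sub>T\<close> with
  itself is the identity. It iterates \<open>branch_inner_sum\<close>.\<close>

lemma collapse_inner_sum:
  "distinct ps \<Longrightarrow> set ps \<subseteq> P \<Longrightarrow>
    (\<Sum>T\<in>Pow (set ps). inner_on \<Omega> (collapse ps T u) (collapse ps T v)) = inner_on \<Omega> u v"
proof (induction ps arbitrary: u v)
  case Nil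
  then show ?case by simp
next
  case (Cons p ps)
  let ?f = "\<lambda>T. inner_on \<Omega> (collapse (p # ps) T u) (collapse (p # ps) T v)"
  \<comment> \<open>The outcome sets are split according to whether the first test \<open>p\<close>
    accepts.\<close>
  have inj: "inj_on (insert p) (Pow (set ps))"
    using Cons.prems by (auto simp: inj_on_def)
  have disj: "Pow (set ps) \<inter> insert p ` Pow (set ps) = {}"
    using Cons.prems(1) by auto
  have "(\<Sum>T\<in>Pow (set (p # ps)). ?f T) = (\<Sum>T\<in>Pow (set ps). ?f T) + (\<Sum>T\<in>insert p ` Pow (set ps). ?f T)"
    unfolding list.set(2) Pow_insert by (rule sum.union_disjoint[OF _ _ disj]) simp_all
  also have "(\<Sum>T\<in>insert p ` Pow (set ps). ?f T) = (\<Sum>T\<in>Pow (set ps). ?f (insert p T))"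
    by (simp add: sum.reindex[OF inj])
  also have "\<dots> = (\<Sum>T\<in>Pow (set ps). inner_on \<Omega> (collapse ps T (Q p u)) (collapse ps T (Q p v)))"
    using Cons.prems by (intro sum.cong) (auto simp: branch_def collapse_insert)
  also have "\<dots> = inner_on \<Omega> (Q p u) (Q p v)"
    using Cons by simp
  also have "(\<Sum>T\<in>Pow (set ps). ?f T) = (\<Sum>T\<in>Pow (set ps). inner_on \<Omega>
      (collapse ps T (\<lambda>\<omega>. u \<omega> - Q p u \<omega>)) (collapse ps T (\<lambda>\<omega>. v \<omega> - Q p v \<omega>)))"
    using Cons.prems by (intro sum.cong) (auto simp: branch_def)
  also have "\<dots> = inner_on \<Omega> (\<lambda>\<omega>. u \<omega> - Q p u \<omega>) (\<lambda>\<omega>. v \<omega> - Q p v \<omega>)"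
    using Cons by simp
  finally show ?case
    using branch_inner_sum[of p u v] Cons.prems by simp
qed

lemma collapse_cong:
  "set ps \<subseteq> P \<Longrightarrow> (\<And>\<omega>. \<omega> \<in> \<Omega> \<Longrightarrow> u \<omega> = v \<omega>) \<Longrightarrow> \<omega> \<in> \<Omega> \<Longrightarrow> collapse ps T u \<omega> = collapse ps T v \<omega>"
proof (induction ps arbitrary: u v)
  case (Cons p ps)
  have "set ps \<subseteq> P" "p \<in> P" using Cons.prems(1) by auto
  moreover have "branch p T u \<omega> = branch p T v \<omega>" if "\<omega> \<in> \<Omega>" for \<omega>
    using Cons.prems(2)[OF that] Q_cong[OF \<open>p \<in> P\<close> Cons.prems(2) that] by (simp add: branch_def)
  ultimately show ?case unfolding collapse.simps using Cons.prems(3) by (intro Cons.IH)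
qed simp

lemma collapse_diff:
  "set ps \<subseteq> P \<Longrightarrow> collapse ps T (\<lambda>\<omega>. u \<omega> - v \<omega>) = (\<lambda>\<omega>. collapse ps T u \<omega> - collapse ps T v \<omega>)"
proof (induction ps arbitrary: u v)
  case (Cons p ps)
  have "branch p T (\<lambda>\<omega>. u \<omega> - v \<omega>) = (\<lambda>\<omega>. branch p T u \<omega> - branch p T v \<omega>)"
    using Cons.prems by (simp add: branch_def Q_diff algebra_simps)
  then show ?case using Cons by simp
qed simp

lemma collapse_sum:
  fixes f :: "'w \<Rightarrow> 'w \<Rightarrow> real"
  shows "set ps \<subseteq> P \<Longrightarrow>
    collapse ps T (\<lambda>\<omega>. \<Sum>a\<in>A. c a * f a \<omega>) = (\<lambda>\<omega>. \<Sum>a\<in>A. c a * collapse ps T (f a) \<omega>)"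
proof (induction ps arbitrary: f)
  case (Cons p ps)
  have "branch p T (\<lambda>\<omega>. \<Sum>a\<in>A. c a * f a \<omega>) = (\<lambda>\<omega>. \<Sum>a\<in>A. c a * branch p T (f a) \<omega>)"
    using Cons.prems by (simp add: branch_def Q_sum right_diff_distrib sum_subtractf)
  then show ?case using Cons by simp
qed simp

text \<open>Hybrid argument: the error made by the first test is carried through the later ones,
  which never increase norms, so the errors add up. Each test is therefore only compared with the
  undisturbed state \<open>u\<close>.\<close>

lemma collapse_dist_le:
  assumes "set ps \<subseteq> P" and "\<And>p. p \<in> set ps \<Longrightarrow> L2_set (\<lambda>\<omega>. branch p T u \<omega> - u \<omega>) \<Omega> \<le> \<eta>"
  shows "L2_set (\<lambda>\<omega>. collapse ps T u \<omega> - u \<omega>) \<Omega> \<le> real (length ps) * \<eta>"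
  using assms
proof (induction ps)
  case Nil
  then show ?case by (simp add: L2_set_def)
next
  case (Cons p ps)
  let ?d = "\<lambda>\<omega>. branch p T u \<omega> - u \<omega>"
  have "L2_set (\<lambda>\<omega>. collapse (p # ps) T u \<omega> - u \<omega>) \<Omega> =
      L2_set (\<lambda>\<omega>. collapse ps T ?d \<omega> + (collapse ps T u \<omega> - u \<omega>)) \<Omega>"
    using Cons.prems by (simp add: collapse_diff)
  also have "\<dots> \<le> L2_set (collapse ps T ?d) \<Omega> + L2_set (\<lambda>\<omega>. collapse ps T u \<omega> - u \<omega>) \<Omega>"
    by (rule L2_set_triangle_ineq)
  also have "L2_set (collapse ps T ?d) \<Omega> \<le> L2_set ?d \<Omega>"
    using Cons.prems collapse_norm_le[of ps T ?d] by (simp add: L2_set_eq_sqrt_inner_on)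
  also have "L2_set ?d \<Omega> \<le> \<eta>"
    using Cons.prems(2)[of p] by simp
  also have "L2_set (\<lambda>\<omega>. collapse ps T u \<omega> - u \<omega>) \<Omega> \<le> real (length ps) * \<eta>"
    using Cons by simp
  finally show ?case by (simp add: algebra_simps)
qed

lemma collapse_norm_ge:
  assumes "set ps \<subseteq> P" and "\<And>p. p \<in> set ps \<Longrightarrow> L2_set (\<lambda>\<omega>. branch p T u \<omega> - u \<omega>) \<Omega> \<le> \<eta>"
  shows "L2_set u \<Omega> - real (length ps) * \<eta> \<le> L2_set (collapse ps T u) \<Omega>"
proof -
  have "L2_set u \<Omega> = L2_set (\<lambda>\<omega>. (u \<omega> - collapse ps T u \<omega>) + collapse ps T u \<omega>) \<Omega>" by simp
  also have "\<dots> \<le> L2_set (\<lambda>\<omega>. u \<omega> - collapse ps T u \<omega>) \<Omega> + L2_set (collapse ps T u) \<Omega>"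
    by (rule L2_set_triangle_ineq)
  also have "L2_set (\<lambda>\<omega>. u \<omega> - collapse ps T u \<omega>) \<Omega> = L2_set (\<lambda>\<omega>. collapse ps T u \<omega> - u \<omega>) \<Omega>"
    by (simp add: L2_set_def power2_commute)
  also have "\<dots> \<le> real (length ps) * \<eta>"
    using assms by (rule collapse_dist_le)
  finally show ?thesis by simp
qed

section \<open>The sequence of tests as a single POVM\<close>

definition unit_at :: "'w \<Rightarrow> 'w \<Rightarrow> real" where
  "unit_at a = (\<lambda>\<omega>. of_bool (\<omega> = a))"

text \<open>Bilinear expansion of \<open>u\<close> in the basis \<open>unit_at\<close>. The
  expansion is an identity on \<open>\<Omega>\<close> only, which is why
  \<open>collapse_cong\<close> enters.\<close>

lemma collapse_inner_expand:
  assumes "set ps \<subseteq> P"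
  shows "(\<Sum>a\<in>\<Omega>. \<Sum>b\<in>\<Omega>. inner_on \<Omega> (collapse ps T (unit_at a)) (collapse ps T (unit_at b)) * (u b * u a))
    = inner_on \<Omega> (collapse ps T u) (collapse ps T u)"
proof -
  have u: "u \<omega> = (\<Sum>a\<in>\<Omega>. u a * unit_at a \<omega>)" if "\<omega> \<in> \<Omega>" for \<omega>
    using finite_index that by (simp add: unit_at_def)
  have c: "collapse ps T u \<omega> = (\<Sum>a\<in>\<Omega>. u a * collapse ps T (unit_at a) \<omega>)" if "\<omega> \<in> \<Omega>" for \<omega>
    using collapse_cong[OF assms u that] by (simp add: collapse_sum[OF assms])
  let ?c = "\<lambda>a \<omega>. collapse ps T (unit_at a) \<omega>"
  have "(\<Sum>a\<in>\<Omega>. \<Sum>b\<in>\<Omega>. inner_on \<Omega> (?c a) (?c b) * (u b * u a)) =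
      (\<Sum>a\<in>\<Omega>. \<Sum>b\<in>\<Omega>. \<Sum>\<omega>\<in>\<Omega>. (u a * ?c a \<omega>) * (u b * ?c b \<omega>))"
    by (simp add: inner_on_def sum_distrib_left sum_distrib_right mult_ac)
  also have "\<dots> = (\<Sum>a\<in>\<Omega>. \<Sum>\<omega>\<in>\<Omega>. \<Sum>b\<in>\<Omega>. (u a * ?c a \<omega>) * (u b * ?c b \<omega>))"
    by (intro sum.cong refl sum.swap)
  also have "\<dots> = (\<Sum>\<omega>\<in>\<Omega>. \<Sum>a\<in>\<Omega>. \<Sum>b\<in>\<Omega>. (u a * ?c a \<omega>) * (u b * ?c b \<omega>))"
    by (rule sum.swap)
  also have "\<dots> = (\<Sum>\<omega>\<in>\<Omega>. collapse ps T u \<omega> * collapse ps T u \<omega>)"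
    by (intro sum.cong refl) (simp only: c sum_product)
  finally show ?thesis by (simp add: inner_on_def)
qed

text \<open>With \<open>K\<^sub>T\<close> the operator \<open>collapse ps T\<close>, this is the sum
  of the adjoint products of \<open>K\<^sub>T\<close> with itself over all outcome sets
  \<open>T\<close> that the classical post-processing \<open>F\<close> sends to
  \<open>r\<close>.\<close>

definition outcome_mat :: "(nat \<Rightarrow> 'w) \<Rightarrow> nat \<Rightarrow> 'p list \<Rightarrow> ('p set \<Rightarrow> 'o) \<Rightarrow> 'o \<Rightarrow> complex mat" where
  "outcome_mat e N ps F r = mat N N (\<lambda>(a, b). complex_of_real
     (\<Sum>T\<in>{T\<in>Pow (set ps). F T = r}.
        inner_on \<Omega> (collapse ps T (unit_at (e a))) (collapse ps T (unit_at (e b)))))"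

lemma povm_outcome_mat:
  assumes e: "bij_betw e {..<N} \<Omega>" and ps: "distinct ps" "set ps \<subseteq> P"
  shows "povm N (F ` Pow (set ps)) (outcome_mat e N ps F)"
  unfolding povm_def
proof (intro conjI ballI allI impI)
  show "finite (F ` Pow (set ps))" by simp
next
  fix r
  show "outcome_mat e N ps F r \<in> carrier_mat N N" by (simp add: outcome_mat_def)
  \<comment> \<open>Indexing by pairs of an outcome set and a basis label brings the matrix into
    Gram form.\<close>
  let ?S = "{T\<in>Pow (set ps). F T = r} \<times> \<Omega>"
  have "outcome_mat e N ps F r = mat N N (\<lambda>(a, b). complex_of_real
      (\<Sum>s\<in>?S. collapse ps (fst s) (unit_at (e a)) (snd s) * collapse ps (fst s) (unit_at (e b)) (snd s)))"
    unfolding outcome_mat_def inner_on_def sum.cartesian_product by (simp add: case_prod_unfold)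
  then show "psd_mat (outcome_mat e N ps F r)" by (simp only: psd_mat_gram)
next
  fix a b assume ab: "a < N" "b < N"
  let ?f = "\<lambda>T. inner_on \<Omega> (collapse ps T (unit_at (e a))) (collapse ps T (unit_at (e b)))"
  have "(\<Sum>r\<in>F ` Pow (set ps). outcome_mat e N ps F r $$ (a, b)) =
      complex_of_real (\<Sum>r\<in>F ` Pow (set ps). \<Sum>T\<in>{T\<in>Pow (set ps). F T = r}. ?f T)"
    using ab by (simp add: outcome_mat_def)
  also have "(\<Sum>r\<in>F ` Pow (set ps). \<Sum>T\<in>{T\<in>Pow (set ps). F T = r}. ?f T) = (\<Sum>T\<in>Pow (set ps). ?f T)"
    by (rule sum.image_gen[symmetric]) simp
  also have "\<dots> = inner_on \<Omega> (unit_at (e a)) (unit_at (e b))"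
    using ps by (rule collapse_inner_sum)
  also have "\<dots> = of_bool (a = b)"
  proof -
    have "e a \<in> \<Omega>" "e b \<in> \<Omega>" "e a = e b \<longleftrightarrow> a = b"
      using e ab by (auto simp: bij_betw_def inj_on_def)
    then show ?thesis
      using finite_index by (cases "a = b") (auto simp: inner_on_def unit_at_def intro!: sum.neutral)
  qed
  finally show "(\<Sum>r\<in>F ` Pow (set ps). outcome_mat e N ps F r $$ (a, b)) = (1\<^sub>m N) $$ (a, b)"
    using ab by simp
qed

text \<open>Born rule for the pure state \<open>u\<close>: the probability of \<open>r\<close> is
  the total squared norm of the unnormalised states left by the outcome sets that lead to
  \<open>r\<close>.\<close>

lemma mtrace_outcome_mat:
  assumes e: "bij_betw e {..<N} \<Omega>" and ps: "set ps \<subseteq> P"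
  shows "mtrace (outcome_mat e N ps F r * mat N N (\<lambda>(a, b). complex_of_real (u (e a) * u (e b)))) =
    complex_of_real (\<Sum>T\<in>{T\<in>Pow (set ps). F T = r}. inner_on \<Omega> (collapse ps T u) (collapse ps T u))"
proof -
  let ?f = "\<lambda>T a b. inner_on \<Omega> (collapse ps T (unit_at a)) (collapse ps T (unit_at b))"
  let ?S = "{T\<in>Pow (set ps). F T = r}"
  have "mtrace (outcome_mat e N ps F r * mat N N (\<lambda>(a, b). complex_of_real (u (e a) * u (e b)))) =
      complex_of_real (\<Sum>a<N. \<Sum>b<N. (\<Sum>T\<in>?S. ?f T (e a) (e b)) * (u (e b) * u (e a)))"
    by (simp add: mtrace_def outcome_mat_def scalar_prod_def atLeast0LessThan)
  also have "(\<Sum>a<N. \<Sum>b<N. (\<Sum>T\<in>?S. ?f T (e a) (e b)) * (u (e b) * u (e a))) =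
      (\<Sum>a\<in>\<Omega>. \<Sum>b\<in>\<Omega>. (\<Sum>T\<in>?S. ?f T a b) * (u b * u a))"
    by (simp add: sum.reindex_bij_betw[OF e, symmetric])
  also have "\<dots> = (\<Sum>a\<in>\<Omega>. \<Sum>b\<in>\<Omega>. \<Sum>T\<in>?S. ?f T a b * (u b * u a))"
    by (simp add: sum_distrib_right)
  also have "\<dots> = (\<Sum>a\<in>\<Omega>. \<Sum>T\<in>?S. \<Sum>b\<in>\<Omega>. ?f T a b * (u b * u a))"
    by (intro sum.cong refl sum.swap)
  also have "\<dots> = (\<Sum>T\<in>?S. \<Sum>a\<in>\<Omega>. \<Sum>b\<in>\<Omega>. ?f T a b * (u b * u a))"
    by (rule sum.swap)
  finally show ?thesis
    by (simp add: collapse_inner_expand[OF ps])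
qed

end

subsection \<open>Swap tests on product states\<close>

text \<open>A basis label \<open>\<omega>\<close> assigns to player \<open>p\<close> and copy
  \<open>c\<close> the symbol \<open>\<omega> p c\<close>; this is the action on labels of
  exchanging players \<open>i\<close> and \<open>j\<close> in the copies of \<open>S\<close>
  only.\<close>

definition swap_copies :: "nat \<Rightarrow> nat \<Rightarrow> nat set \<Rightarrow> (nat \<Rightarrow> nat \<Rightarrow> 'b) \<Rightarrow> nat \<Rightarrow> nat \<Rightarrow> 'b" where
  "swap_copies i j S \<omega> = (\<lambda>p c. if c \<in> S then \<omega> (transpose i j p) c else \<omega> p c)"

text \<open>Expanding the product over all copies of \<open>(1 + SWAP) / 2\<close> gives this
  average, so it is the event that the swap tests of all \<open>m\<close> copies accept.\<close>

definition swap_test :: "nat \<Rightarrow> nat \<times> nat \<Rightarrow> ((nat \<Rightarrow> nat \<Rightarrow> 'b) \<Rightarrow> real) \<Rightarrow> (nat \<Rightarrow> nat \<Rightarrow> 'b) \<Rightarrow> real" where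
  "swap_test m p u \<omega> = (\<Sum>S\<in>Pow {..<m}. u (swap_copies (fst p) (snd p) S \<omega>)) / 2 ^ m"

lemma swap_copies_swap_copies:
  "swap_copies i j S (swap_copies i j T \<omega>) = swap_copies i j (sym_diff S T) \<omega>"
  by (auto simp: swap_copies_def fun_eq_iff)

lemma swap_copies_in_PiE:
  assumes "i < k" "j < k" "S \<subseteq> {..<m}" and \<omega>: "\<omega> \<in> {..<k} \<rightarrow>\<^sub>E ({..<m} \<rightarrow>\<^sub>E B)"
  shows "swap_copies i j S \<omega> \<in> {..<k} \<rightarrow>\<^sub>E ({..<m} \<rightarrow>\<^sub>E B)"
proof (rule PiE_I)
  have tr: "transpose i j p < k \<longleftrightarrow> p < k" for p
    using assms(1,2) by (auto simp: transpose_def)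
  have mem: "\<omega> p c \<in> B" if "p < k" "c < m" for p c
    using \<omega> that by (meson PiE_mem lessThan_iff)
  have und: "\<omega> p c = undefined" if "p < k" "\<not> c < m" for p c
    using \<omega> that by (meson PiE_arb PiE_mem lessThan_iff)
  fix p assume p: "p \<in> {..<k}"
  show "swap_copies i j S \<omega> p \<in> {..<m} \<rightarrow>\<^sub>E B"
    using p tr assms(3) by (intro PiE_I) (auto simp: swap_copies_def mem und)
next
  fix p assume "p \<notin> {..<k}"
  moreover from this have "transpose i j p = p"
    using assms(1,2) by (auto simp: transpose_def)
  ultimately show "swap_copies i j S \<omega> p = undefined"
    using PiE_arb[OF \<omega>] by (auto simp: swap_copies_def fun_eq_iff)
qed

text \<open>The swap permutes the basis as an involution, so its matrix is symmetric.\<close>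

lemma inner_on_swap_copies:
  fixes B :: "'b set" and m k :: nat
  defines "\<Omega> \<equiv> {..<k} \<rightarrow>\<^sub>E ({..<m} \<rightarrow>\<^sub>E B)"
  assumes "i < k" "j < k" "S \<subseteq> {..<m}"
  shows "inner_on \<Omega> (\<lambda>\<omega>. u (swap_copies i j S \<omega>)) v = inner_on \<Omega> u (\<lambda>\<omega>. v (swap_copies i j S \<omega>))"
proof -
  have inv: "swap_copies i j S (swap_copies i j S \<omega>) = \<omega>" for \<omega> :: "nat \<Rightarrow> nat \<Rightarrow> 'b"
    by (simp add: swap_copies_swap_copies) (simp add: swap_copies_def)
  have "swap_copies i j S \<omega> \<in> \<Omega>" if "\<omega> \<in> \<Omega>" for \<omega>
    using swap_copies_in_PiE that assms by metis
  then show ?thesis unfolding inner_on_def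
    by (intro sum.reindex_bij_witness[of _ "swap_copies i j S" "swap_copies i j S"]) (auto simp: inv)
qed

text \<open>The swaps form a group under symmetric difference of the sets of copies, and averaging
  over a group is idempotent: composing with one element only permutes the summands.\<close>

lemma swap_test_idem:
  fixes u :: "(nat \<Rightarrow> nat \<Rightarrow> 'b) \<Rightarrow> real"
  shows "swap_test m p (swap_test m p u) = swap_test m p u"
proof
  fix \<omega> :: "nat \<Rightarrow> nat \<Rightarrow> 'b"
  let ?s = "swap_copies (fst p) (snd p)" and ?P = "Pow {..<m}"
  have "(\<Sum>T\<in>?P. u (?s T (?s S \<omega>))) = (\<Sum>T\<in>?P. u (?s T \<omega>))" if "S \<in> ?P" for S
    using that
    by (intro sum.reindex_bij_witness[of _ "\<lambda>T. sym_diff T S" "\<lambda>T. sym_diff T S"])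
       (auto simp: swap_copies_swap_copies intro!: arg_cong[of _ _ u] arg_cong[of _ _ "\<lambda>T. ?s T \<omega>"])
  then show "swap_test m p (swap_test m p u) \<omega> = swap_test m p u \<omega>"
    by (simp add: swap_test_def sum_divide_distrib[symmetric] card_Pow)
qed

lemma projective_tests_swap_test:
  fixes B :: "'b set"
  assumes "finite B"
  shows "projective_tests ({..<k} \<rightarrow>\<^sub>E ({..<m} \<rightarrow>\<^sub>E B)) ({..<k} \<times> {..<k}) (swap_test m)"
    (is "projective_tests ?\<Omega> ?P _")
proof
  show "finite ?\<Omega>" using assms by (intro finite_PiE) auto
next
  fix p :: "nat \<times> nat" and u v :: "(nat \<Rightarrow> nat \<Rightarrow> 'b) \<Rightarrow> real" and \<omega>
  assume p: "p \<in> ?P" and uv: "\<And>\<omega>. \<omega> \<in> ?\<Omega> \<Longrightarrow> u \<omega> = v \<omega>" and \<omega>: "\<omega> \<in> ?\<Omega>"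
  have "u (swap_copies (fst p) (snd p) S \<omega>) = v (swap_copies (fst p) (snd p) S \<omega>)" if "S \<in> Pow {..<m}" for S
    using p \<omega> that by (intro uv swap_copies_in_PiE) auto
  then show "swap_test m p u \<omega> = swap_test m p v \<omega>" by (simp add: swap_test_def)
next
  fix p :: "nat \<times> nat" and u v :: "(nat \<Rightarrow> nat \<Rightarrow> 'b) \<Rightarrow> real"
  show "swap_test m p (\<lambda>\<omega>. u \<omega> - v \<omega>) = (\<lambda>\<omega>. swap_test m p u \<omega> - swap_test m p v \<omega>)"
    by (simp add: swap_test_def fun_eq_iff sum_subtractf diff_divide_distrib)
next
  fix p :: "nat \<times> nat" and A c and f :: "(nat \<Rightarrow> nat \<Rightarrow> 'b) \<Rightarrow> (nat \<Rightarrow> nat \<Rightarrow> 'b) \<Rightarrow> real"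
  show "swap_test m p (\<lambda>\<omega>. \<Sum>a\<in>A. c a * f a \<omega>) = (\<lambda>\<omega>. \<Sum>a\<in>A. c a * swap_test m p (f a) \<omega>)"
  proof
    fix \<omega>
    show "swap_test m p (\<lambda>\<omega>. \<Sum>a\<in>A. c a * f a \<omega>) \<omega> = (\<Sum>a\<in>A. c a * swap_test m p (f a) \<omega>)"
      unfolding swap_test_def by (subst sum.swap) (simp add: sum_divide_distrib sum_distrib_left)
  qed
next
  fix p :: "nat \<times> nat" and u v :: "(nat \<Rightarrow> nat \<Rightarrow> 'b) \<Rightarrow> real"
  assume p: "p \<in> ?P"
  let ?s = "swap_copies (fst p) (snd p)"
  have l: "inner_on ?\<Omega> (swap_test m p u) v = (\<Sum>S\<in>Pow {..<m}. inner_on ?\<Omega> (\<lambda>\<omega>. u (?s S \<omega>)) v) / 2 ^ m" for u v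
    unfolding inner_on_def swap_test_def
    by (subst sum.swap) (simp add: sum_distrib_right sum_divide_distrib)
  have "inner_on ?\<Omega> (swap_test m p u) v = (\<Sum>S\<in>Pow {..<m}. inner_on ?\<Omega> u (\<lambda>\<omega>. v (?s S \<omega>))) / 2 ^ m"
    unfolding l using p by (intro arg_cong[of _ _ "\<lambda>s. s / 2 ^ m"] sum.cong inner_on_swap_copies) auto
  \<comment> \<open>With every swap moved to \<open>v\<close>, the fact \<open>l\<close> with
    \<open>u\<close> and \<open>v\<close> exchanged collects the average again.\<close>
  also have "\<dots> = inner_on ?\<Omega> (swap_test m p v) u"
    unfolding l by (simp add: inner_on_def mult.commute)
  finally show "inner_on ?\<Omega> (swap_test m p u) v = inner_on ?\<Omega> u (swap_test m p v)"
    by (simp add: inner_on_def mult.commute)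
qed (rule swap_test_idem)

section \<open>Acceptance of swap tests on product states\<close>

definition product_state :: "nat \<Rightarrow> nat \<Rightarrow> ('y \<Rightarrow> 'b \<Rightarrow> real) \<Rightarrow> (nat \<Rightarrow> 'y) \<Rightarrow> (nat \<Rightarrow> nat \<Rightarrow> 'b) \<Rightarrow> real" where
  "product_state k m \<phi> x \<omega> = (\<Prod>p<k. \<Prod>c<m. \<phi> (x p) (\<omega> p c))"

text \<open>Swapping basis labels amounts to swapping the players' inputs, by reindexing the product
  over players. This is done for each copy separately, as the permutation depends on whether
  \<open>c \<in> S\<close>.\<close>

lemma product_state_swap_copies:
  assumes "i < k" "j < k"
  shows "product_state k m \<phi> x (swap_copies i j S \<omega>) =
    (\<Prod>p<k. \<Prod>c<m. \<phi> (x (if c \<in> S then transpose i j p else p)) (\<omega> p c))"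
proof -
  have perm: "transpose i j permutes {..<k}" using assms by (intro permutes_swap_id) auto
  have "product_state k m \<phi> x (swap_copies i j S \<omega>) =
      (\<Prod>c<m. \<Prod>p<k. \<phi> (x p) (\<omega> (if c \<in> S then transpose i j p else p) c))"
    unfolding product_state_def by (subst prod.swap) (auto simp: swap_copies_def intro!: prod.cong)
  also have "\<dots> = (\<Prod>c<m. \<Prod>p<k. \<phi> (x (if c \<in> S then transpose i j p else p)) (\<omega> p c))"
  proof (rule prod.cong[OF refl])
    fix c
    show "(\<Prod>p<k. \<phi> (x p) (\<omega> (if c \<in> S then transpose i j p else p) c)) =
        (\<Prod>p<k. \<phi> (x (if c \<in> S then transpose i j p else p)) (\<omega> p c))"
      using prod.permute[OF perm, of "\<lambda>p. \<phi> (x p) (\<omega> (transpose i j p) c)"]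
      by (cases "c \<in> S") (simp_all add: o_def)
  qed
  also have "\<dots> = (\<Prod>p<k. \<Prod>c<m. \<phi> (x (if c \<in> S then transpose i j p else p)) (\<omega> p c))"
    by (rule prod.swap)
  finally show ?thesis .
qed

lemma sum_PiE_prod_prod:
  fixes f :: "nat \<Rightarrow> nat \<Rightarrow> 'b \<Rightarrow> real"
  assumes "finite B"
  shows "(\<Sum>\<omega>\<in>{..<k} \<rightarrow>\<^sub>E ({..<m} \<rightarrow>\<^sub>E B). \<Prod>p<k. \<Prod>c<m. f p c (\<omega> p c)) = (\<Prod>p<k. \<Prod>c<m. \<Sum>b\<in>B. f p c b)"
  using assms by (simp add: prod_sum_PiE finite_PiE)

lemma inner_on_product_state_swap_copies:
  assumes "finite B" "i < k" "j < k"
  shows "inner_on ({..<k} \<rightarrow>\<^sub>E ({..<m} \<rightarrow>\<^sub>E B)) (product_state k m \<phi> x)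
      (\<lambda>\<omega>. product_state k m \<phi> x (swap_copies i j S \<omega>)) =
    (\<Prod>c<m. \<Prod>p<k. inner_on B (\<phi> (x p)) (\<phi> (x (if c \<in> S then transpose i j p else p))))"
  unfolding inner_on_def product_state_swap_copies[OF assms(2,3)]
  unfolding product_state_def prod.distrib[symmetric]
  by (subst prod.swap) (rule sum_PiE_prod_prod[OF assms(1)])

lemma swap_test_product_state_equal:
  assumes "i < k" "j < k" "x i = x j"
  shows "swap_test m (i, j) (product_state k m \<phi> x) = product_state k m \<phi> x"
proof -
  have "x (if c \<in> S then transpose i j p else p) = x p" for S :: "nat set" and c p
    using assms(3) by (auto simp: transpose_def)
  then have "product_state k m \<phi> x (swap_copies i j S \<omega>) = product_state k m \<phi> x \<omega>" for S \<omega>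
    unfolding product_state_swap_copies[OF assms(1,2)] by (simp add: product_state_def)
  then show ?thesis by (simp add: swap_test_def fun_eq_iff card_Pow)
qed

text \<open>For a projection the squared norm is the average over \<open>S\<close> of the overlaps
  of the state with its swapped versions. These factorise over copies, every copy in
  \<open>S\<close> contributes at most \<open>1/2\<close>, and the average of
  \<open>(1/2) ^ card S\<close> is \<open>(3/4) ^ m\<close>.\<close>

lemma swap_test_product_state_unequal:
  fixes \<phi> :: "'y \<Rightarrow> 'b \<Rightarrow> real"
  defines "\<Omega> \<equiv> \<lambda>k m B. {..<k::nat} \<rightarrow>\<^sub>E ({..<m::nat} \<rightarrow>\<^sub>E (B :: 'b set))"
  assumes B: "finite B" and ij: "i < k" "j < k"
    and G: "\<And>p r. p < k \<Longrightarrow> r < k \<Longrightarrow> 0 \<le> inner_on B (\<phi> (x p)) (\<phi> (x r)) \<and> inner_on B (\<phi> (x p)) (\<phi> (x r)) \<le> 1"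
    and half: "inner_on B (\<phi> (x i)) (\<phi> (x j)) \<le> 1/2"
  shows "inner_on (\<Omega> k m B) (swap_test m (i, j) (product_state k m \<phi> x)) (swap_test m (i, j) (product_state k m \<phi> x))
    \<le> (3/4) ^ m"
proof -
  interpret projective_tests "\<Omega> k m B" "{..<k} \<times> {..<k}" "swap_test m"
    unfolding \<Omega>_def using B by (rule projective_tests_swap_test)
  let ?\<Psi> = "product_state k m \<phi> x"
  let ?tr = "transpose i j"
  have tr: "?tr p < k" if "p < k" for p using that ij by (auto simp: transpose_def)
  have G': "0 \<le> inner_on B (\<phi> (x p)) (\<phi> (x (if b then ?tr p else p)))"
      "inner_on B (\<phi> (x p)) (\<phi> (x (if b then ?tr p else p))) \<le> 1" if "p < k" for p b
    using G that tr by auto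
  have swap: "(\<Prod>p<k. inner_on B (\<phi> (x p)) (\<phi> (x (if b then ?tr p else p)))) \<le> (if b then 1/2 else 1)" for b
  proof (cases b)
    case True
    \<comment> \<open>The bound \<open>1/2\<close> is taken from the factor of player
      \<open>i\<close> alone; all other factors lie between 0 and 1.\<close>
    have "(\<Prod>p<k. inner_on B (\<phi> (x p)) (\<phi> (x (?tr p)))) =
        inner_on B (\<phi> (x i)) (\<phi> (x j)) * (\<Prod>p\<in>{..<k} - {i}. inner_on B (\<phi> (x p)) (\<phi> (x (?tr p))))"
      using ij by (simp add: prod.remove[of _ i])
    also have "\<dots> \<le> 1/2 * 1"
      using half G'[of _ True] G ij by (intro mult_mono prod_le_1 prod_nonneg) auto
    finally show ?thesis using True by simp
  next
    case False
    then show ?thesis using G'[of _ b] by (simp only: if_False) (intro prod_le_1, simp)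
  qed
  have "inner_on (\<Omega> k m B) (swap_test m (i, j) ?\<Psi>) (swap_test m (i, j) ?\<Psi>) =
      inner_on (\<Omega> k m B) ?\<Psi> (swap_test m (i, j) ?\<Psi>)"
    using ij by (simp add: Q_self_adjoint Q_idem)
  also have "\<dots> = (\<Sum>S\<in>Pow {..<m}. inner_on (\<Omega> k m B) ?\<Psi> (\<lambda>\<omega>. ?\<Psi> (swap_copies i j S \<omega>))) / 2 ^ m"
    unfolding inner_on_def swap_test_def by (subst sum.swap) (simp add: sum_distrib_left sum_divide_distrib)
  also have "\<dots> \<le> (\<Sum>S\<in>Pow {..<m}. (1/2) ^ card S) / 2 ^ m"
  proof (intro divide_right_mono sum_mono)
    fix S assume S: "S \<in> Pow {..<m}"
    have "inner_on (\<Omega> k m B) ?\<Psi> (\<lambda>\<omega>. ?\<Psi> (swap_copies i j S \<omega>)) \<le> (\<Prod>c<m. if c \<in> S then 1/2 else 1)"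
      unfolding \<Omega>_def inner_on_product_state_swap_copies[OF B ij]
      using G' swap by (intro prod_mono conjI prod_nonneg) auto
    also have "\<dots> = (\<Prod>c\<in>S. 1/2)"
      using S by (intro prod.mono_neutral_cong_right) auto
    finally show "inner_on (\<Omega> k m B) ?\<Psi> (\<lambda>\<omega>. ?\<Psi> (swap_copies i j S \<omega>)) \<le> (1/2) ^ card S" by simp
  qed simp
  \<comment> \<open>The sum over \<open>S\<close> is the expanded product of \<open>m\<close>
    factors \<open>1/2 + 1\<close>.\<close>
  also have "(\<Sum>S\<in>Pow {..<m}. (1/2) ^ card S) = (3/2 :: real) ^ m"
    using prod_add[of "{..<m}" "\<lambda>_. 1/2 :: real" "\<lambda>_. 1"] by simp
  finally show ?thesis by (simp add: power_divide[symmetric])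
qed

lemma product_state_norm:
  assumes "finite B" "\<And>p. p < k \<Longrightarrow> inner_on B (\<phi> (x p)) (\<phi> (x p)) = 1"
  shows "inner_on ({..<k} \<rightarrow>\<^sub>E ({..<m} \<rightarrow>\<^sub>E B)) (product_state k m \<phi> x) (product_state k m \<phi> x) = 1"
proof -
  have "inner_on ({..<k} \<rightarrow>\<^sub>E ({..<m} \<rightarrow>\<^sub>E B)) (product_state k m \<phi> x) (product_state k m \<phi> x) =
      (\<Prod>p<k. \<Prod>c<m. inner_on B (\<phi> (x p)) (\<phi> (x p)))"
    unfolding inner_on_def product_state_def prod.distrib[symmetric]
    by (rule sum_PiE_prod_prod[OF assms(1)])
  then show ?thesis using assms by simp
qed

subsection \<open>The protocol\<close>

definition fingerprint :: "nat \<Rightarrow> ('y \<Rightarrow> nat \<Rightarrow> nat) \<Rightarrow> 'y \<Rightarrow> nat \<times> nat \<Rightarrow> real" where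
  "fingerprint L c y = (\<lambda>(t, a). of_bool (a = c y t) / sqrt (real L))"

text \<open>In position \<open>t\<close> only the symbol \<open>c y t\<close> contributes, so
  overlaps are agreement rates and the code property becomes the bound \<open>1/2\<close> on
  overlaps.\<close>

lemma inner_on_fingerprint:
  assumes "\<And>t. t < L \<Longrightarrow> c y t < A" and "L > 0"
  shows "inner_on ({..<L} \<times> {..<A}) (fingerprint L c y) (fingerprint L c z) =
    real (card {t\<in>{..<L}. c y t = c z t}) / real L"
proof -
  have "inner_on ({..<L} \<times> {..<A}) (fingerprint L c y) (fingerprint L c z) =
      (\<Sum>t<L. \<Sum>a<A. if a = c y t then of_bool (c y t = c z t) / real L else 0)"
    unfolding inner_on_def sum.cartesian_product
    by (intro sum.cong refl) (auto simp: fingerprint_def)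
  also have "\<dots> = (\<Sum>t<L. of_bool (c y t = c z t) / real L)"
    using assms by (intro sum.cong refl) (simp add: sum.delta)
  also have "\<dots> = real (card {t\<in>{..<L}. c y t = c z t}) / real L"
    by (simp add: sum_divide_distrib[symmetric] Int_def)
  finally show ?thesis .
qed

definition copies_state :: "nat \<Rightarrow> ('b \<Rightarrow> real) \<Rightarrow> (nat \<Rightarrow> 'b) \<Rightarrow> real" where
  "copies_state m \<psi> f = (\<Prod>c<m. \<psi> (f c))"

text \<open>A pure state is a Gram matrix with a single index, and the trace factorises into
  \<open>m\<close> squared norms of \<open>\<psi>\<close>.\<close>

lemma density_mat_copies_state:
  assumes B: "finite B" and norm: "inner_on B \<psi> \<psi> = 1"
    and h: "bij_betw h {..<d} ({..<m} \<rightarrow>\<^sub>E B)"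
  shows "density_mat d (mat d d (\<lambda>(a, b). complex_of_real (copies_state m \<psi> (h a) * copies_state m \<psi> (h b))))"
    (is "density_mat d ?A")
  unfolding density_mat_def
proof (intro conjI)
  show "?A \<in> carrier_mat d d" by simp
  show "psd_mat ?A"
    using psd_mat_gram[where N = d and S = "{()}" and g = "\<lambda>_ a. copies_state m \<psi> (h a)"] by simp
  have "mtrace ?A = complex_of_real (\<Sum>a<d. (copies_state m \<psi> (h a) * copies_state m \<psi> (h a)))"
    by (simp add: mtrace_def)
  also have "(\<Sum>a<d. (copies_state m \<psi> (h a) * copies_state m \<psi> (h a))) =
      (\<Sum>f\<in>{..<m} \<rightarrow>\<^sub>E B. copies_state m \<psi> f * copies_state m \<psi> f)"
    using h by (rule sum.reindex_bij_betw)
  also have "\<dots> = (\<Sum>f\<in>{..<m} \<rightarrow>\<^sub>E B. \<Prod>c<m. \<psi> (f c) * \<psi> (f c))"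
    by (simp add: copies_state_def prod.distrib)
  also have "\<dots> = (\<Prod>c<m. inner_on B \<psi> \<psi>)"
    unfolding inner_on_def using B by (intro prod_sum_PiE[symmetric]) auto
  finally show "mtrace ?A = 1" using norm by simp
qed

text \<open>Rounding the logarithm up costs less than 1, and 1 is at most
  \<open>log 2 (real n)\<close>, hence the factor 2.\<close>

lemma exists_log2_bound:
  assumes "n \<ge> 2"
  shows "\<exists>l\<ge>1. n \<le> 2 ^ l \<and> real l \<le> 2 * log 2 (real n)"
proof (intro exI conjI)
  let ?l = "nat \<lceil>log 2 (real n)\<rceil>"
  have 1: "log 2 (real n) \<ge> 1" using assms by (subst le_log_iff) auto
  then show "?l \<ge> 1" by linarith
  have "real n = 2 powr log 2 (real n)" using assms by simp
  also have "\<dots> \<le> 2 powr real ?l" using 1 by (intro powr_mono) linarith+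
  finally have "real n \<le> real (2 ^ ?l)" by (simp add: powr_realpow)
  then show "n \<le> 2 ^ ?l" by (simp only: of_nat_le_iff)
  show "real ?l \<le> 2 * log 2 (real n)" using 1 by linarith
qed

text \<open>The rows of the relation \<open>T\<close> of accepted pairs. An outcome \<open>T\<close>
  need not be an equivalence relation; the referee then still outputs this family, even if it is no
  partition.\<close>

definition groups_of :: "nat \<Rightarrow> (nat \<times> nat) set \<Rightarrow> nat set set" where
  "groups_of k T = (\<lambda>i. {j\<in>{..<k}. (i, j) \<in> T}) ` {..<k}"

lemma groupByEQ_correct_groups_of:
  "groupByEQ_correct k x (groups_of k {(i, j) \<in> {..<k} \<times> {..<k}. x i = x j})"
proof -
  let ?C = "\<lambda>i. {j\<in>{..<k}. x i = x j}"
  have g: "groups_of k {(i, j) \<in> {..<k} \<times> {..<k}. x i = x j} = ?C ` {..<k}"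
    unfolding groups_of_def by (intro image_cong refl) auto
  show ?thesis unfolding groupByEQ_correct_def g
  proof (intro conjI allI impI)
    show "partition_on {..<k} (?C ` {..<k})"
      by (rule partition_onI) (auto simp: disjnt_def)
  next
    fix i j assume "i < k" "j < k"
    then show "(\<exists>D\<in>?C ` {..<k}. i \<in> D \<and> j \<in> D) \<longleftrightarrow> x i = x j" by auto
  qed
qed

text \<open>The code has length \<open>2 * h\<close> over 16 symbols, so a fingerprint lives in
  dimension \<open>2 ^ r\<close> and takes \<open>r\<close> qubits, and \<open>m\<close> copies are
  sent. The bound on \<open>m\<close> lets each of the \<open>k ^ 2\<close> tests disturb the state
  by at most \<open>1 / (10 * real k ^ 2)\<close>.\<close>

lemma swap_protocol:
  assumes k: "k \<ge> 1" and n: "n \<le> 2 * h" and B: "2 * h * 16 = 2 ^ r" and m: "(3/4 :: real) ^ m \<le> (1 / (10 * real k ^ 2))\<^sup>2"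
    and h0: "h > 0"
  shows "\<exists>(enc :: nat \<Rightarrow> bool list \<Rightarrow> complex mat) (Out :: nat set set set) (E :: nat set set \<Rightarrow> complex mat).
    valid_smp_protocol k n (\<lambda>_. r * m) enc Out E \<and>
    (\<forall>x :: nat \<Rightarrow> bool list. (\<forall>i<k. length (x i) = n) \<longrightarrow>
       success_prob k enc Out E (groupByEQ_correct k x) x \<ge> 2 / 3)"
proof -
  let ?Y = "{y :: bool list. length y = n}"
  have Y: "?Y = {y. set y \<subseteq> UNIV \<and> length y = n}" by simp
  have "finite ?Y" unfolding Y by (rule finite_lists_length_eq) simp
  moreover have "card ?Y \<le> 2 ^ (2*h)"
    unfolding Y by (subst card_lists_length_eq) (use n in \<open>auto intro: power_increasing\<close>)
  ultimately have "\<exists>c :: bool list \<Rightarrow> nat \<Rightarrow> nat. (\<forall>y\<in>?Y. c y \<in> {..<2*h} \<rightarrow>\<^sub>E {..<16}) \<and>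
    (\<forall>y\<in>?Y. \<forall>z\<in>?Y. y \<noteq> z \<longrightarrow> card {t\<in>{..<2*h}. c y t = c z t} \<le> h)"
    by (rule half_agreement_code_exists)
  then obtain c :: "bool list \<Rightarrow> nat \<Rightarrow> nat"
    where c: "\<forall>y\<in>?Y. c y \<in> {..<2*h} \<rightarrow>\<^sub>E {..<16}"
    and agree: "\<forall>y\<in>?Y. \<forall>z\<in>?Y. y \<noteq> z \<longrightarrow> card {t\<in>{..<2*h}. c y t = c z t} \<le> h"
    by (elim exE conjE)
  define \<phi> where "\<phi> = fingerprint (2*h) c"
  define D where "D = {..<2*h} \<times> {..<16::nat}"
  have D: "finite D" "card D = 2 ^ r" using B by (auto simp: D_def)
  have clt: "c y t < 16" if "length y = n" "t < 2*h" for y t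
    using bspec[OF c, of y] that by (simp add: PiE_iff)
  have G: "inner_on D (\<phi> y) (\<phi> z) = real (card {t\<in>{..<2*h}. c y t = c z t}) / real (2*h)" if "length y = n" for y z
    unfolding D_def \<phi>_def using clt that h0 by (intro inner_on_fingerprint) auto
  have G1: "inner_on D (\<phi> y) (\<phi> y) = 1" if "length y = n" for y
    using G[OF that, of y] h0 by simp
  have G01: "0 \<le> inner_on D (\<phi> y) (\<phi> z) \<and> inner_on D (\<phi> y) (\<phi> z) \<le> 1" if "length y = n" for y z
  proof -
    have "card {t\<in>{..<2*h}. c y t = c z t} \<le> card {..<2*h}" by (intro card_mono) auto
    then have "real (card {t\<in>{..<2*h}. c y t = c z t}) \<le> real (2*h)" by (simp only: card_lessThan of_nat_le_iff)
    then show ?thesis using G[OF that, of z] h0 by (simp only: G[OF that]) (simp add: divide_le_eq_1)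
  qed
  have Ghalf: "inner_on D (\<phi> y) (\<phi> z) \<le> 1/2" if "length y = n" "length z = n" "y \<noteq> z" for y z
  proof -
    have "real (card {t\<in>{..<2*h}. c y t = c z t}) \<le> real h"
      using agree that by simp
    then show ?thesis using h0 by (simp only: G[OF that(1)]) (simp add: divide_simps)
  qed
  define W where "W = {..<m} \<rightarrow>\<^sub>E D"
  define d where "d = (2::nat) ^ (r * m)"
  have "finite W" "card W = d"
    using D by (simp_all add: W_def d_def card_PiE finite_PiE power_mult)
  \<comment> \<open>From here on \<open>h\<close> enumerates the basis of one message; it no longer
    stands for half of the code length.\<close>
  then obtain h where "bij_betw h {0..<d} W" using ex_bij_betw_nat_finite by blast
  then have h: "bij_betw h {..<d} W" by (simp add: atLeast0LessThan)
  define N where "N = d ^ k"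
  define \<Omega> where "\<Omega> = {..<k} \<rightarrow>\<^sub>E W"
  obtain e where e: "bij_betw e {..<N} \<Omega>"
    and kron: "\<And>A g. (\<forall>i<k. A i = mat d d (\<lambda>(a, b). g i (h a) (h b))) \<Longrightarrow>
      foldr kron (map A [0..<k]) (1\<^sub>m 1) = mat N N (\<lambda>(a, b). \<Prod>i<k. g i (e a i) (e b i))"
    using foldr_kron_entries[OF h, of k] unfolding N_def \<Omega>_def by blast
  interpret projective_tests \<Omega> "{..<k} \<times> {..<k}" "swap_test m"
    unfolding \<Omega>_def W_def using D by (intro projective_tests_swap_test)
  let ?P = "{..<k} \<times> {..<k}"
  \<comment> \<open>All ordered pairs are tested, the diagonal included, in an arbitrary
    order.\<close>
  obtain ps where ps: "set ps = ?P" "distinct ps"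
    using finite_distinct_list[of ?P] by auto
  have len: "length ps = k ^ 2"
    using distinct_card[OF ps(2)] ps(1) by (simp add: power2_eq_square)
  define enc where "enc = (\<lambda>(i::nat) y. mat d d (\<lambda>(a, b).
    complex_of_real (copies_state m (\<phi> y) (h a) * copies_state m (\<phi> y) (h b))))"
  define Out where "Out = groups_of k ` Pow (set ps)"
  define E where "E = outcome_mat e N ps (groups_of k)"
  have cost: "2 ^ smp_cost k (\<lambda>_. r * m) = N"
    by (simp add: smp_cost_def N_def d_def power_mult[symmetric] mult.commute)
  have "valid_smp_protocol k n (\<lambda>_. r * m) enc Out E"
    unfolding valid_smp_protocol_def cost
  proof (intro conjI allI impI)
    fix i and y :: "bool list" assume "length y = n"
    then show "density_mat (2 ^ (r * m)) (enc i y)"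
      unfolding enc_def d_def[symmetric] using D(1) G1 h
      by (intro density_mat_copies_state[where B = D]) (simp_all add: W_def)
  next
    show "povm N Out E"
      unfolding Out_def E_def using e ps by (intro povm_outcome_mat) auto
  qed
  moreover have "success_prob k enc Out E (groupByEQ_correct k x) x \<ge> 2 / 3"
    if x: "\<forall>i<k. length (x i) = n" for x
  proof -
    let ?\<Psi> = "product_state k m \<phi> x"
    \<comment> \<open>The outcome in which every test answers correctly for the input
      \<open>x\<close>.\<close>
    define T where "T = {(i, j) \<in> ?P. x i = x j}"
    define \<eta> where "\<eta> = 1 / (10 * real k ^ 2)"
    have "joint_state k enc x = mat N N (\<lambda>(a, b). \<Prod>i<k.
        complex_of_real (copies_state m (\<phi> (x i)) (e a i) * copies_state m (\<phi> (x i)) (e b i)))"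
      unfolding joint_state_def by (rule kron) (simp add: enc_def)
    also have "\<dots> = mat N N (\<lambda>(a, b). complex_of_real (?\<Psi> (e a) * ?\<Psi> (e b)))"
      by (simp add: copies_state_def product_state_def prod.distrib)
    finally have joint: "joint_state k enc x = mat N N (\<lambda>(a, b). complex_of_real (?\<Psi> (e a) * ?\<Psi> (e b)))" .
    define w where "w = (\<lambda>S. inner_on \<Omega> (collapse ps S ?\<Psi>) (collapse ps S ?\<Psi>))"
    have w0: "w S \<ge> 0" for S unfolding w_def by (rule inner_on_self_nonneg)
    have tr: "Re (mtrace (E g * joint_state k enc x)) = (\<Sum>S\<in>{S\<in>Pow (set ps). groups_of k S = g}. w S)" for g
      unfolding E_def joint w_def by (subst mtrace_outcome_mat[OF e]) (simp_all add: ps)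
    have T: "T \<in> Pow (set ps)" by (auto simp: T_def ps)
    \<comment> \<open>Several outcome sets may yield the same family, and several families might
      count as correct; a lower bound by the single term of \<open>T\<close> is enough.\<close>
    have "w T \<le> (\<Sum>S\<in>{S\<in>Pow (set ps). groups_of k S = groups_of k T}. w S)"
      using T w0 by (intro member_le_sum) auto
    also have "\<dots> = Re (mtrace (E (groups_of k T) * joint_state k enc x))"
      by (simp add: tr)
    also have "\<dots> \<le> success_prob k enc Out E (groupByEQ_correct k x) x"
      unfolding success_prob_def
    proof (rule member_le_sum)
      show "groups_of k T \<in> {g \<in> Out. groupByEQ_correct k x g}"
        using T groupByEQ_correct_groups_of[of k x] by (simp add: Out_def T_def)
      show "finite {g \<in> Out. groupByEQ_correct k x g}" by (simp add: Out_def)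
    qed (simp add: tr sum_nonneg w0)
    finally have success: "w T \<le> success_prob k enc Out E (groupByEQ_correct k x) x" .
    have "L2_set (\<lambda>\<omega>. branch p T ?\<Psi> \<omega> - ?\<Psi> \<omega>) \<Omega> \<le> \<eta>" if mem: "p \<in> set ps" for p
    proof -
      obtain i j where p: "p = (i, j)" "i < k" "j < k" using mem ps by auto
      show ?thesis
      proof (cases "x i = x j")
        case True
        then have "branch p T ?\<Psi> = ?\<Psi>"
          using p by (simp add: branch_def T_def swap_test_product_state_equal)
        then show ?thesis by (simp add: L2_set_def \<eta>_def)
      next
        case False
        \<comment> \<open>The correct outcome is rejection, so the disturbance is exactly the
          accepted component.\<close>
        then have "L2_set (\<lambda>\<omega>. branch p T ?\<Psi> \<omega> - ?\<Psi> \<omega>) \<Omega> = L2_set (swap_test m (i, j) ?\<Psi>) \<Omega>"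
          using p by (simp add: branch_def T_def L2_set_def)
        also have "\<dots> \<le> sqrt ((3/4) ^ m)"
          unfolding L2_set_eq_sqrt_inner_on \<Omega>_def W_def
          using p False x D(1) G01 Ghalf
          by (intro real_sqrt_le_mono swap_test_product_state_unequal) auto
        also have "\<dots> \<le> \<eta>"
          using m by (intro real_le_lsqrt) (auto simp: \<eta>_def)
        finally show ?thesis .
      qed
    qed
    then have "L2_set ?\<Psi> \<Omega> - real (length ps) * \<eta> \<le> L2_set (collapse ps T ?\<Psi>) \<Omega>"
      using ps by (intro collapse_norm_ge) auto
    moreover have "L2_set ?\<Psi> \<Omega> = 1"
      unfolding L2_set_eq_sqrt_inner_on \<Omega>_def W_def using D(1) G1 x by (simp add: product_state_norm)
    moreover have "real (length ps) * \<eta> = 1/10"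
      using k by (simp add: len \<eta>_def)
    \<comment> \<open>Unit norm minus the total disturbance \<open>1/10\<close>; squaring gives
      probability at least \<open>81/100\<close>.\<close>
    ultimately have "9/10 \<le> sqrt (w T)" by (simp add: w_def L2_set_eq_sqrt_inner_on)
    then have "(9/10)\<^sup>2 \<le> w T" using w0[of T] by (simp add: real_le_rsqrt real_sqrt_le_iff sqrt_ge_absD)
    then have "2/3 \<le> w T" by (simp add: power2_eq_square)
    with success show ?thesis by linarith
  qed
  ultimately show ?thesis by blast
qed

theorem theorem7:
  "\<exists>C::real. C > 0 \<and>
     (\<forall>k n::nat. k \<ge> 2 \<longrightarrow> n \<ge> 2 \<longrightarrow>
       (\<exists>(q :: nat \<Rightarrow> nat) (enc :: nat \<Rightarrow> bool list \<Rightarrow> complex mat)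
          (Out :: nat set set set) (E :: nat set set \<Rightarrow> complex mat).
          valid_smp_protocol k n q enc Out E \<and>
          real (smp_cost k q) \<le> C * real k * log 2 (real k) * log 2 (real n) \<and>
          (\<forall>x :: nat \<Rightarrow> bool list. (\<forall>i<k. length (x i) = n) \<longrightarrow>
             success_prob k enc Out E (groupByEQ_correct k x) x \<ge> 2 / 3)))"
proof (intro exI[of _ 270] conjI allI impI)
  fix k n :: nat assume k: "k \<ge> 2" and n: "n \<ge> 2"
  obtain \<kappa> where \<kappa>: "\<kappa> \<ge> 1" "k \<le> 2 ^ \<kappa>" "real \<kappa> \<le> 2 * log 2 (real k)" using exists_log2_bound[OF k] by blast
  obtain l where l: "l \<ge> 1" "n \<le> 2 ^ l" "real l \<le> 2 * log 2 (real n)" using exists_log2_bound[OF n] by blast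
  \<comment> \<open>Rounding the code length up to the power \<open>2 ^ l\<close> makes the
    fingerprint fill whole qubits; the 16 symbols account for the 4 in \<open>r\<close>.\<close>
  define h where "h = (2::nat) ^ (l - 1)"
  define r where "r = l + 4"
  \<comment> \<open>Three copies give \<open>(3/4) ^ 3 = 27/64 < 1/2\<close>. Then
    \<open>4 * \<kappa>\<close> halvings pay for \<open>real k ^ 4\<close>, and 7 more give
    \<open>128\<close>, which exceeds the required \<open>100\<close>.\<close>
  define m where "m = 3 * (7 + 4 * \<kappa>)"
  have h: "2 * h = 2 ^ l" using l(1) by (simp add: h_def power_eq_if)
  have "(3/4 :: real) ^ m = (27/64) ^ (7 + 4 * \<kappa>)"
    unfolding m_def power_mult by (simp add: power3_eq_cube)
  also have "\<dots> \<le> (1/2) ^ (7 + 4 * \<kappa>)" by (intro power_mono) auto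
  also have "\<dots> = 1 / (128 * (2 ^ \<kappa>) ^ 4)"
    by (simp add: power_add power_divide power_mult[symmetric] mult.commute)
  also have "\<dots> \<le> 1 / (100 * real k ^ 4)"
  proof -
    have "real k \<le> 2 ^ \<kappa>" using \<kappa>(2) by (metis of_nat_le_iff of_nat_numeral of_nat_power)
    then have "real k ^ 4 \<le> (2 ^ \<kappa>) ^ 4" by (intro power_mono) auto
    then have "100 * real k ^ 4 \<le> 128 * (2 ^ \<kappa>) ^ 4" by (intro mult_mono) auto
    then show ?thesis using k by (intro divide_left_mono) auto
  qed
  also have "\<dots> = (1 / (10 * real k ^ 2))\<^sup>2"
    by (simp add: power_divide power_mult_distrib power_mult[symmetric])
  finally have "(3/4 :: real) ^ m \<le> (1 / (10 * real k ^ 2))\<^sup>2" .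
  moreover have "n \<le> 2 * h" using l h by simp
  moreover have "2 * h * 16 = 2 ^ r" by (simp add: h r_def power_add)
  moreover have "h > 0" by (simp add: h_def)
  ultimately obtain enc and Out :: "nat set set set" and E
    where prot: "valid_smp_protocol k n (\<lambda>_. r * m) enc Out E"
    "\<And>x. \<forall>i<k. length (x i) = n \<Longrightarrow> success_prob k enc Out E (groupByEQ_correct k x) x \<ge> 2 / 3"
    using swap_protocol[of k n h r m] k by auto
  have lk: "log 2 (real k) \<ge> 1" and ln: "log 2 (real n) \<ge> 1"
    using k n by (simp_all add: le_log_iff)
  \<comment> \<open>As both logarithms are at least 1, \<open>l + 4\<close> is at most
    \<open>2 + 4\<close> times \<open>log 2 (real n)\<close> and \<open>21 + 12 * \<kappa>\<close>
    at most \<open>21 + 24\<close> times \<open>log 2 (real k)\<close>; the constant is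
    \<open>6 * 45 = 270\<close>.\<close>
  have "real r \<le> 6 * log 2 (real n)" using l(3) ln by (simp add: r_def)
  moreover have "real m \<le> 45 * log 2 (real k)" using \<kappa>(3) lk by (simp add: m_def)
  ultimately have "real r * real m \<le> (6 * log 2 (real n)) * (45 * log 2 (real k))"
    using ln by (intro mult_mono) auto
  then have "real k * (real r * real m) \<le> real k * (6 * log 2 (real n) * (45 * log 2 (real k)))"
    by (intro mult_left_mono) auto
  then have "real (smp_cost k (\<lambda>_. r * m)) \<le> 270 * real k * log 2 (real k) * log 2 (real n)"
    by (simp add: smp_cost_def mult_ac)
  then show "\<exists>q enc (Out :: nat set set set) E. valid_smp_protocol k n q enc Out E \<and>
      real (smp_cost k q) \<le> 270 * real k * log 2 (real k) * log 2 (real n) \<and>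
      (\<forall>x. (\<forall>i<k. length (x i) = n) \<longrightarrow> success_prob k enc Out E (groupByEQ_correct k x) x \<ge> 2 / 3)"
    using prot by blast
qed simp

end
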